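(* Let $X$ be a topological space satisfying ${\sf S}_1(\Omega_X,\Omega_X)$. Then for each countable $A\in\Omega_X$ (with a fixed bijective enumeration), every subset of $[A]^{\aleph_0}\cap\Omega_X$ which has the Baire property in the Ellentuck topology on $[A]^{\aleph_0}\cap\Omega_X$ is completely Ramsey.
   Context: An $\omega$-cover of $X$ is an open cover $\mathcal{U}$ with $X\notin\mathcal{U}$ such that each finite subset of $X$ lies in some member of $\mathcal{U}$; $\Omega_X$ is the set of $\omega$-covers. ${\sf S}_1(\Omega_X,\Omega_X)$: for every sequence of $\omega$-covers $(\mathcal{U}_n)$ there are $U_n\in\mathcal{U}_n$ with $\{U_n:n\in\mathbb{N}\}$ an $\omega$-cover. $[S]^{\aleph_0}$ denotes the countably infinite subsets of $S$. With the enumeration $A=\{a_n:n\in\mathbb{N}\}$: for $s,T\subseteq A$, $s<T$ means $a_n\in s$, $a_m\in T$ imply $n<m$; $B|s=\{a_n\in B:s<\{a_n\}\}$; for finite $s$ and infinite $C$ with $s<C$, $[s,C]=\{s\cup D: D\in[A]^{\aleph_0},D\subseteq C\}$. The sets $[s,C]$ form a base of the Ellentuck topology on $[A]^{\aleph_0}$, and $[A]^{\aleph_0}\cap\Omega_X$ carries the subspace topology. A set has the Baire property if it is of the form $(U\setminus M)\cup(M\setminus U)$ with $U$ open and $M$ meager. A set $R\subseteq[A]^{\aleph_0}\cap\Omega_X$ is completely Ramsey if for every finite $s\subseteq A$ and every $B\in[A|s]^{\aleph_0}\cap\Omega_X$ there is $C\in[B]^{\aleph_0}\cap\Omega_X$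 with either $[s,C]\cap\Omega_X\subseteq R$ or $[s,C]\cap\Omega_X\cap R=\emptyset$. *)

theory Defs
  imports "HOL-Analysis.Analysis"
begin

definition omega_covers :: "'x topology \<Rightarrow> 'x set set set" where
  "omega_covers X = {\<U>. (\<forall>U\<in>\<U>. openin X U) \<and> \<Union>\<U> = topspace X \<and> topspace X \<notin> \<U> \<and>
     (\<forall>F. finite F \<and> F \<subseteq> topspace X \<longrightarrow> (\<exists>U\<in>\<U>. F \<subseteq> U))}"

definition S1 :: "'b set set \<Rightarrow> 'b set set \<Rightarrow> bool" where
  "S1 \<A> \<B> \<longleftrightarrow>
     (\<forall>\<U> :: nat \<Rightarrow> 'b set. (\<forall>n. \<U> n \<in> \<A>) \<longrightarrow>
        (\<exists>V. (\<forall>n. V n \<in> \<U> n) \<and> range V \<in> \<B>))"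

definition inf_subsets :: "'b set \<Rightarrow> 'b set set" where
  "inf_subsets S = {D. D \<subseteq> S \<and> countable D \<and> infinite D}"

text \<open>Below, \<open>a\<close> is a bijective enumeration of the set \<open>A\<close>.\<close>

definition enum_less :: "(nat \<Rightarrow> 'b) \<Rightarrow> 'b set \<Rightarrow> 'b set \<Rightarrow> bool" where
  "enum_less a s T \<longleftrightarrow> (\<forall>n m. a n \<in> s \<longrightarrow> a m \<in> T \<longrightarrow> n < m)"

definition enum_above :: "(nat \<Rightarrow> 'b) \<Rightarrow> 'b set \<Rightarrow> 'b set \<Rightarrow> 'b set" where
  "enum_above a B s = {b \<in> B. enum_less a s {b}}"

definition ellentuck_box :: "'b set \<Rightarrow> 'b set \<Rightarrow> 'b set \<Rightarrow> 'b set set" where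
  "ellentuck_box A s C = {s \<union> D | D. D \<in> inf_subsets A \<and> D \<subseteq> C}"

definition ellentuck_base :: "(nat \<Rightarrow> 'b) \<Rightarrow> 'b set \<Rightarrow> 'b set set set" where
  "ellentuck_base a A =
     {ellentuck_box A s C | s C. finite s \<and> s \<subseteq> A \<and> C \<in> inf_subsets A \<and> enum_less a s C}"

definition ellentuck_topology :: "(nat \<Rightarrow> 'b) \<Rightarrow> 'b set \<Rightarrow> 'b set topology" where
  "ellentuck_topology a A = topology (arbitrary union_of (\<lambda>U. U \<in> ellentuck_base a A))"

definition meager_in :: "'b topology \<Rightarrow> 'b set \<Rightarrow> bool" where
  "meager_in T M \<longleftrightarrow>
     (\<exists>N :: nat \<Rightarrow> 'b set.
        (\<forall>n. N n \<subseteq> topspace T \<and> T interior_of (T closure_of N n) = {}) \<and> M = (\<Union>n. N n))"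

definition has_baire_property :: "'b topology \<Rightarrow> 'b set \<Rightarrow> bool" where
  "has_baire_property T R \<longleftrightarrow>
     (\<exists>U M. openin T U \<and> meager_in T M \<and> R = (U - M) \<union> (M - U))"

definition completely_Ramsey ::
    "'x topology \<Rightarrow> (nat \<Rightarrow> 'x set) \<Rightarrow> 'x set set \<Rightarrow> 'x set set set \<Rightarrow> bool" where
  "completely_Ramsey X a A R \<longleftrightarrow>
     R \<subseteq> inf_subsets A \<inter> omega_covers X \<and>
     (\<forall>s B. finite s \<and> s \<subseteq> A \<and> B \<in> inf_subsets (enum_above a A s) \<inter> omega_covers X \<longrightarrow>
        (\<exists>C \<in> inf_subsets B \<inter> omega_covers X.
           ellentuck_box A s C \<inter> omega_covers X \<subseteq> R \<or>
           ellentuck_box A s C \<inter> omega_covers X \<inter> R = {}))"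

text \<open>The boxes really form a base, so \<open>ellentuck_topology\<close> is not a degenerate value of
  \<open>topology\<close>.\<close>

lemma ellentuck_base_Int:
  assumes P: "P \<in> ellentuck_base a A" and Q: "Q \<in> ellentuck_base a A" and E: "E \<in> P \<inter> Q"
  shows "\<exists>W \<in> ellentuck_base a A. E \<in> W \<and> W \<subseteq> P \<inter> Q"
proof -
  obtain s C where s: "P = ellentuck_box A s C" "finite s" "s \<subseteq> A" "C \<in> inf_subsets A"
    "enum_less a s C" using P unfolding ellentuck_base_def by blast
  obtain t D where t: "Q = ellentuck_box A t D" "finite t" "t \<subseteq> A" "D \<in> inf_subsets A"
    "enum_less a t D" using Q unfolding ellentuck_base_def by blast
  obtain E1 where E1: "E = s \<union> E1" "E1 \<in> inf_subsets A" "E1 \<subseteq> C"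
    using E s(1) unfolding ellentuck_box_def by blast
  obtain E2 where E2: "E = t \<union> E2" "E2 \<in> inf_subsets A" "E2 \<subseteq> D"
    using E t(1) unfolding ellentuck_box_def by blast
  define u where "u = s \<union> t"
  define F where "F = E - u"
  have u: "finite u" "u \<subseteq> A" using s t by (auto simp: u_def)
  have "infinite E" "countable E" "E \<subseteq> A"
    using E1 s(2,3) by (auto simp: inf_subsets_def countable_finite)
  then have F: "F \<in> inf_subsets A"
    using u by (auto simp: F_def inf_subsets_def)
  have Fsub: "F \<subseteq> E1" "F \<subseteq> E2" using E1 E2 by (auto simp: F_def u_def)
  have uF: "enum_less a u F"
    using s(5) t(5) Fsub E1(3) E2(3) unfolding enum_less_def u_def by blast
  have "ellentuck_box A u F \<in> ellentuck_base a A"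
    using u F uF unfolding ellentuck_base_def by blast
  moreover have "E \<in> ellentuck_box A u F"
  proof -
    have "E = u \<union> F" using E1(1) E2(1) by (auto simp: F_def u_def)
    then show ?thesis using F unfolding ellentuck_box_def by blast
  qed
  moreover have "ellentuck_box A u F \<subseteq> P \<inter> Q"
  proof
    fix Z assume "Z \<in> ellentuck_box A u F"
    then obtain G where G: "Z = u \<union> G" "G \<in> inf_subsets A" "G \<subseteq> F"
      unfolding ellentuck_box_def by blast
    have 1: "Z = s \<union> ((t - s) \<union> G)" "Z = t \<union> ((s - t) \<union> G)" using G by (auto simp: u_def)
    have 2: "t - s \<subseteq> E1" "s - t \<subseteq> E2" using E1(1) E2(1) by blast+
    have 3: "(t - s) \<union> G \<in> inf_subsets A" "(s - t) \<union> G \<in> inf_subsets A"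
      using G(2) s(2,3) t(2,3) by (auto simp: inf_subsets_def countable_finite)
    have 4: "(t - s) \<union> G \<subseteq> C" "(s - t) \<union> G \<subseteq> D"
      using 2 G(3) Fsub E1(3) E2(3) by blast+
    have "Z \<in> P"
      unfolding s(1) ellentuck_box_def using 1(1) 3(1) 4(1) by blast
    moreover have "Z \<in> Q"
      unfolding t(1) ellentuck_box_def using 1(2) 3(2) 4(2) by blast
    ultimately show "Z \<in> P \<inter> Q" by blast
  qed
  ultimately show ?thesis by blast
qed

lemma openin_ellentuck_topology:
  "openin (ellentuck_topology a A) = arbitrary union_of (\<lambda>U. U \<in> ellentuck_base a A)"
proof -
  have "istopology (arbitrary union_of (\<lambda>U. U \<in> ellentuck_base a A))"
    unfolding istopology_base_eq
  proof (intro allI impI, elim conjE)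
    fix P Q assume PQ: "P \<in> ellentuck_base a A" "Q \<in> ellentuck_base a A"
    show "(arbitrary union_of (\<lambda>U. U \<in> ellentuck_base a A)) (P \<inter> Q)"
      unfolding arbitrary_union_of_alt
      using ellentuck_base_Int[OF PQ] by blast
  qed
  then show ?thesis
    unfolding ellentuck_topology_def by (rule topology_inverse')
qed

lemma topspace_ellentuck_topology:
  assumes "bij_betw a UNIV A"
  shows "topspace (ellentuck_topology a A) = inf_subsets A"
proof -
  have A: "A \<in> inf_subsets A"
  proof -
    have "A = range a" "inj a" using assms by (auto simp: bij_betw_def)
    then have "infinite A" "countable A" using range_inj_infinite[of a] by simp_all
    then show ?thesis by (simp add: inf_subsets_def)
  qed
  have "topspace (ellentuck_topology a A) = \<Union>(ellentuck_base a A)"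
    unfolding topspace_def openin_ellentuck_topology
    by (auto simp: union_of_def arbitrary_def)
  moreover have "inf_subsets A \<in> ellentuck_base a A"
  proof -
    have "inf_subsets A = ellentuck_box A {} A"
      by (auto simp: ellentuck_box_def inf_subsets_def)
    then show ?thesis
      using A unfolding ellentuck_base_def enum_less_def by blast
  qed
  moreover have "P \<subseteq> inf_subsets A" if "P \<in> ellentuck_base a A" for P
    using that by (auto simp: ellentuck_base_def ellentuck_box_def inf_subsets_def countable_finite)
  ultimately show ?thesis by blast
qed

end

theory Submission
  imports Defs
begin

text \<open>Pulled back along the enumeration, the \<open>\<omega>\<close>-covers contained in \<open>A\<close> form a coideal
  of infinite sets of naturals, and \<open>S\<^sub>1(\<Omega>,\<Omega>)\<close> makes this coideal selective: every decreasing
  sequence of its members has a diagonal intersection in it. For a selective coideal the classical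
  proof of Ellentuck's theorem goes through: by fusion one finds a set that accepts or rejects all
  of its finite subsets, so open sets are Ramsey; hence a box can be shrunk so as to avoid a given
  nowhere dense set, and, by another fusion, a given meager set. On such a box a set with the Baire
  property coincides with an open set.\<close>

section \<open>Ellentuck's theorem for selective coideals\<close>

text \<open>The index version of \<open>enum_above\<close>; the tail above the empty set is all of
  \<open>C\<close>.\<close>

definition elems_above :: "nat set \<Rightarrow> nat set \<Rightarrow> nat set" where
  "elems_above s C = {m \<in> C. \<forall>k\<in>s. k < m}"

lemma elems_above_subset: "elems_above s C \<subseteq> C"
  by (auto simp: elems_above_def)

lemma finite_diff_elems_above: "finite s \<Longrightarrow> finite (C - elems_above s C)"
proof -
  assume "finite s"
  then have "finite (\<Union>k\<in>s. {..k})" by blast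
  moreover have "C - elems_above s C \<subseteq> (\<Union>k\<in>s. {..k})"
    by (auto simp: elems_above_def not_less)
  ultimately show ?thesis by (rule finite_subset[rotated])
qed

text \<open>The first three axioms make \<open>H\<close> the complement of an ideal containing the
  finite sets; the last is selectivity, as in Mathias's happy families. The index
  \<open>Suc n\<close> fits the fusion, where \<open>S (Suc n)\<close> is the stage that has treated
  all subsets of \<open>{..n}\<close>.\<close>

locale selective_coideal =
  fixes H :: "nat set set"
  assumes H_infinite: "C \<in> H \<Longrightarrow> infinite C"
    and H_mono: "\<lbrakk>C \<in> H; C \<subseteq> D\<rbrakk> \<Longrightarrow> D \<in> H"
    and H_Un: "C \<union> D \<in> H \<Longrightarrow> C \<in> H \<or> D \<in> H"
    and H_diagonal: "\<lbrakk>\<And>n. S n \<in> H; decseq S\<rbrakk> \<Longrightarrow>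
      \<exists>C\<in>H. C \<subseteq> S 0 \<and> (\<forall>n\<in>C. \<forall>m\<in>C. n < m \<longrightarrow> m \<in> S (Suc n))"
begin

section \<open>Dense hereditary properties and fusion\<close>

lemma H_finite_diff:
  assumes "E \<in> H" "finite (E - G)"
  shows "G \<in> H"
proof -
  have "(E - G) \<union> (E \<inter> G) \<in> H" using assms(1) by (simp add: Un_Diff_Int Un_commute)
  then have "E \<inter> G \<in> H" using H_Un H_infinite assms(2) by blast
  then show ?thesis using H_mono by blast
qed

lemma H_elems_above: "\<lbrakk>C \<in> H; finite s\<rbrakk> \<Longrightarrow> elems_above s C \<in> H"
  using H_finite_diff finite_diff_elems_above by blast

lemma finite_family_dense:
  assumes "finite I"
    and dense: "\<And>i B. \<lbrakk>i \<in> I; B \<in> H\<rbrakk> \<Longrightarrow> \<exists>C\<in>H. C \<subseteq> B \<and> Q i C"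
    and hered: "\<And>i C D. \<lbrakk>i \<in> I; Q i C; D \<subseteq> C; D \<in> H\<rbrakk> \<Longrightarrow> Q i D"
    and "B \<in> H"
  shows "\<exists>C\<in>H. C \<subseteq> B \<and> (\<forall>i\<in>I. Q i C)"
  using assms(1) dense hered
proof (induction I)
  case empty
  then show ?case using \<open>B \<in> H\<close> by auto
next
  case (insert i I)
  have "\<exists>C\<in>H. C \<subseteq> B \<and> (\<forall>i\<in>I. Q i C)"
    by (rule insert.IH; rule insert.prems; blast)
  then obtain C where C: "C \<in> H" "C \<subseteq> B" "\<forall>i\<in>I. Q i C" by blast
  obtain D where "D \<in> H" "D \<subseteq> C" "Q i D" using insert.prems(1)[of i C] C by auto
  moreover have "\<forall>i\<in>I. Q i D" using insert.prems(2) C calculation by blast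
  ultimately show ?case using C by blast
qed

text \<open>A decreasing sequence \<open>S\<close> in \<open>H\<close> is built such that
  \<open>S n\<close> has \<open>Q\<close> for all subsets of \<open>{..<n}\<close>. In a diagonal
  intersection \<open>C\<close>, everything above a set \<open>t\<close> with maximum
  \<open>n\<close> lies in \<open>S (Suc n)\<close>, which was made good for \<open>t\<close>, and
  \<open>hered\<close> carries this over to the tail of \<open>C\<close>.\<close>

lemma fusion:
  assumes dense: "\<And>t B. \<lbrakk>finite t; B \<in> H\<rbrakk> \<Longrightarrow> \<exists>C\<in>H. C \<subseteq> B \<and> Q t C"
    and hered: "\<And>t C D. \<lbrakk>finite t; Q t C; D \<subseteq> C; D \<in> H\<rbrakk> \<Longrightarrow> Q t D"
    and "B \<in> H"
  shows "\<exists>C\<in>H. C \<subseteq> B \<and> (\<forall>t. finite t \<and> t \<subseteq> C \<longrightarrow> Q t (elems_above t C))"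
proof -
  have ex: "\<exists>C\<in>H. C \<subseteq> B \<and> (\<forall>t\<in>Pow {..<n}. Q t C)" if "B \<in> H" for B n
    by (rule finite_family_dense[OF _ _ _ that])
      (auto intro: dense hered finite_subset[of _ "{..<n}"])
  have "\<exists>S. \<forall>n. (S n \<in> H \<and> S n \<subseteq> B \<and> (\<forall>t\<in>Pow {..<n}. Q t (S n))) \<and> S (Suc n) \<subseteq> S n"
  proof (rule dependent_nat_choice)
    show "\<exists>C. C \<in> H \<and> C \<subseteq> B \<and> (\<forall>t\<in>Pow {..<0}. Q t C)" using ex[OF \<open>B \<in> H\<close>, of 0] by blast
  next
    fix C n assume C: "C \<in> H \<and> C \<subseteq> B \<and> (\<forall>t\<in>Pow {..<n}. Q t C)"
    then obtain D where "D \<in> H" "D \<subseteq> C" "\<forall>t\<in>Pow {..<Suc n}. Q t D" using ex[of C "Suc n"] by blast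
    then show "\<exists>D. (D \<in> H \<and> D \<subseteq> B \<and> (\<forall>t\<in>Pow {..<Suc n}. Q t D)) \<and> D \<subseteq> C" using C by blast
  qed
  then obtain S where S: "\<And>n. S n \<in> H \<and> S n \<subseteq> B \<and> (\<forall>t\<in>Pow {..<n}. Q t (S n))"
    "\<And>n. S (Suc n) \<subseteq> S n" by blast
  have "decseq S" using S(2) by (simp add: decseq_Suc_iff)
  then obtain C where C: "C \<in> H" "C \<subseteq> S 0" "\<And>n m. \<lbrakk>n \<in> C; m \<in> C; n < m\<rbrakk> \<Longrightarrow> m \<in> S (Suc n)"
    using H_diagonal[of S] S(1) by blast
  have "Q t (elems_above t C)" if t: "finite t" "t \<subseteq> C" for t
  proof (cases "t = {}")
    \<comment> \<open>The empty set has no maximum; it was treated at stage \<open>S 0\<close>,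
      which contains \<open>C\<close>.\<close>
    case True
    then show ?thesis using hered[of t "S 0" "elems_above t C"] S(1)[of 0] C by (auto simp: elems_above_def)
  next
    case False
    define n where "n = Max t"
    have n: "n \<in> t" "\<And>k. k \<in> t \<Longrightarrow> k \<le> n" using t False by (auto simp: n_def)
    have "elems_above t C \<subseteq> S (Suc n)" using n C(3) t by (auto simp: elems_above_def)
    moreover have "Q t (S (Suc n))" using S(1)[of "Suc n"] n(2) by (auto simp: less_Suc_eq_le)
    ultimately show ?thesis using hered t C(1) H_elems_above by blast
  qed
  moreover have "C \<subseteq> B" using C(2) S(1)[of 0] by blast
  ultimately show ?thesis using C(1) by auto
qed

section \<open>Boxes and the Ramsey property of open sets\<close>

text \<open>The trace on \<open>H\<close> of an Ellentuck neighbourhood. The stem need not lie below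
  the reservoir, so \<open>box s E\<close> with \<open>s \<subseteq> E\<close> is allowed.\<close>

definition box :: "nat set \<Rightarrow> nat set \<Rightarrow> nat set set" where
  "box s C = {E \<in> H. s \<subseteq> E \<and> E \<subseteq> s \<union> C}"

lemma box_mono: "C \<subseteq> D \<Longrightarrow> box s C \<subseteq> box s D"
  by (auto simp: box_def)

text \<open>Openness of the trace of \<open>U\<close> on \<open>H\<close>. The reservoir may be
  \<open>E\<close> itself, since any \<open>box s C\<close> containing \<open>E\<close> also
  contains \<open>box s E\<close>.\<close>

definition ell_open :: "nat set set \<Rightarrow> bool" where
  "ell_open U \<longleftrightarrow> (\<forall>E \<in> U \<inter> H. \<exists>s \<subseteq> E. finite s \<and> box s E \<subseteq> U)"

text \<open>Acceptance argument in the style of Galvin and Prikry: \<open>D\<close> accepts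
  \<open>t\<close> if \<open>box (s \<union> t) D \<subseteq> U\<close>, and rejects
  \<open>t\<close> if no subset of \<open>D\<close> in \<open>H\<close> accepts it. One fusion
  yields a \<open>C\<close> whose tails decide all its finite subsets. A second one makes rejection
  pass from \<open>t\<close> to \<open>insert n t\<close>, so if the empty set is rejected, all
  finite subsets are.\<close>

lemma decide_all_or_reject_all:
  assumes "finite s" "B \<in> H"
  shows "\<exists>C\<in>H. C \<subseteq> B \<and> (box s C \<subseteq> U \<or>
    (\<forall>t D. finite t \<and> t \<subseteq> C \<and> D \<in> H \<and> D \<subseteq> elems_above t C \<longrightarrow> \<not> box (s \<union> t) D \<subseteq> U))"
proof -
  define dec where "dec t C \<longleftrightarrow> box (s \<union> t) C \<subseteq> U \<or> (\<forall>D\<in>H. D \<subseteq> C \<longrightarrow> \<not> box (s \<union> t) D \<subseteq> U)"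
    for t C
  have "\<exists>C\<in>H. C \<subseteq> B \<and> (\<forall>t. finite t \<and> t \<subseteq> C \<longrightarrow> dec t (elems_above t C))"
  proof (rule fusion)
    show "\<exists>C\<in>H. C \<subseteq> G \<and> dec t C" if "G \<in> H" for t G
      using that unfolding dec_def by blast
    show "dec t D" if "dec t C" "D \<subseteq> C" for t C D
      using that box_mono[of D C "s \<union> t"] unfolding dec_def by (meson order_trans)
  qed (fact \<open>B \<in> H\<close>)
  then obtain C where C: "C \<in> H" "C \<subseteq> B"
    and dec: "\<forall>t. finite t \<and> t \<subseteq> C \<longrightarrow> dec t (elems_above t C)"
    by blast
  define rej where "rej t \<longleftrightarrow> (\<forall>D\<in>H. D \<subseteq> elems_above t C \<longrightarrow> \<not> box (s \<union> t) D \<subseteq> U)" for t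
  have decided: "box (s \<union> t) (elems_above t C) \<subseteq> U" if "finite t" "t \<subseteq> C" "\<not> rej t" for t
    using that dec unfolding dec_def rej_def[symmetric] by metis
  \<comment> \<open>Otherwise the \<open>n\<close> for which \<open>insert n t\<close> is accepted
    would form a set \<open>E\<close> in \<open>H\<close>, and \<open>E\<close> would accept the
    rejected \<open>t\<close>. The guard \<open>n \<in> C\<close> is there because the fusion asks
    for an arbitrary \<open>G\<close> in \<open>H\<close>.\<close>
  have extend: "{n \<in> elems_above t G. n \<in> C \<longrightarrow> rej (insert n t)} \<in> H"
    if t: "finite t" "t \<subseteq> C" "rej t" and G: "G \<in> H" for t G
  proof (rule ccontr)
    let ?R = "{n \<in> elems_above t G. n \<in> C \<longrightarrow> rej (insert n t)}"
    define E where "E = elems_above t G - ?R"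
    assume "?R \<notin> H"
    moreover have "?R \<union> E = elems_above t G" by (auto simp: E_def)
    ultimately have E: "E \<in> H" using H_elems_above[OF G t(1)] H_Un by metis
    have EC: "E \<subseteq> elems_above t C" by (auto simp: E_def elems_above_def)
    then obtain F where F: "F \<in> H" "s \<union> t \<subseteq> F" "F \<subseteq> s \<union> t \<union> E" "F \<notin> U"
      using t(3) E unfolding rej_def box_def by blast
    \<comment> \<open>All other new elements of \<open>F\<close> lie above the least one, so
      \<open>F\<close> falls into the box accepted for \<open>insert n t\<close>.\<close>
    define n where "n = (LEAST n. n \<in> F - (s \<union> t))"
    have "infinite (F - (s \<union> t))" using H_infinite[OF F(1)] \<open>finite s\<close> t(1) by simp
    then obtain k where "k \<in> F - (s \<union> t)" by (metis finite.emptyI equals0I)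
    then have nF: "n \<in> F - (s \<union> t)" unfolding n_def by (rule LeastI)
    have nmin: "n \<le> m" if "m \<in> F - (s \<union> t)" for m unfolding n_def using that by (rule Least_le)
    have nE: "n \<in> E" "n \<in> C" using nF F(3) EC elems_above_subset[of t C] by auto
    then have "\<not> rej (insert n t)" by (auto simp: E_def)
    then have "box (s \<union> insert n t) (elems_above (insert n t) C) \<subseteq> U"
      using decided[of "insert n t"] t nE by simp
    moreover have "F \<in> box (s \<union> insert n t) (elems_above (insert n t) C)"
    proof -
      have "m \<in> elems_above (insert n t) C" if "m \<in> F" "m \<notin> s \<union> insert n t" for m
        using that nmin[of m] F(3) EC by (force simp: elems_above_def)
      then show ?thesis using F(1,2) nF by (auto simp: box_def)
    qed
    ultimately show False using F(4) by blast
  qed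
  have "\<exists>D\<in>H. D \<subseteq> C \<and> (\<forall>t. finite t \<and> t \<subseteq> D \<longrightarrow>
      t \<subseteq> C \<and> rej t \<longrightarrow> (\<forall>n \<in> elems_above t D. n \<in> C \<longrightarrow> rej (insert n t)))"
  proof (rule fusion[where Q = "\<lambda>t D. t \<subseteq> C \<and> rej t \<longrightarrow> (\<forall>n\<in>D. n \<in> C \<longrightarrow> rej (insert n t))"])
    fix t G :: "nat set" assume t: "finite t" and G: "G \<in> H"
    show "\<exists>D\<in>H. D \<subseteq> G \<and> (t \<subseteq> C \<and> rej t \<longrightarrow> (\<forall>n\<in>D. n \<in> C \<longrightarrow> rej (insert n t)))"
    proof (cases "t \<subseteq> C \<and> rej t")
      case True
      then show ?thesis using extend[OF t _ _ G] elems_above_subset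
        by (intro bexI[of _ "{n \<in> elems_above t G. n \<in> C \<longrightarrow> rej (insert n t)}"]) auto
    qed (use G in blast)
  qed (use C in auto)
  then obtain D where D: "D \<in> H" "D \<subseteq> C"
    "\<And>t n. \<lbrakk>finite t; t \<subseteq> D; rej t; n \<in> elems_above t D\<rbrakk> \<Longrightarrow> rej (insert n t)"
    by (meson elems_above_subset order_trans subsetD)
  show ?thesis
  proof (cases "rej {}")
    case False
    then have "box s C \<subseteq> U" using decided[of "{}"] by (simp add: elems_above_def)
    then show ?thesis using C by blast
  next
    case True
    \<comment> \<open>Elements are added in increasing order, since rejection passes on only to
      \<open>n\<close> in \<open>elems_above t D\<close>.\<close>
    have "t \<subseteq> D \<longrightarrow> rej t" if "finite t" for t
      using that
    proof (induction t rule: finite_linorder_max_induct)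
      case (insert n t)
      then show ?case using D(3)[of t n] by (auto simp: elems_above_def)
    qed (use True in simp)
    moreover have "elems_above t D \<subseteq> elems_above t C" for t using D(2) by (auto simp: elems_above_def)
    ultimately have "\<forall>t G. finite t \<and> t \<subseteq> D \<and> G \<in> H \<and> G \<subseteq> elems_above t D \<longrightarrow> \<not> box (s \<union> t) G \<subseteq> U"
      unfolding rej_def by (meson order_trans)
    then show ?thesis using C D by (meson order_trans)
  qed
qed

text \<open>If \<open>C\<close> rejects all its finite subsets, no \<open>E\<close> in
  \<open>box s C\<close> can lie in \<open>U\<close>: a neighbourhood \<open>box r E\<close> inside
  \<open>U\<close> would contain some \<open>box (s \<union> t) G\<close> with
  \<open>t \<subseteq> C\<close>, against the rejection of \<open>t\<close>.\<close>

lemma ell_open_Ramsey: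
  assumes "ell_open U" "finite s" "B \<in> H"
  shows "\<exists>C\<in>H. C \<subseteq> B \<and> (box s C \<subseteq> U \<or> box s C \<inter> U = {})"
proof -
  obtain C where C: "C \<in> H" "C \<subseteq> B" and dec: "box s C \<subseteq> U \<or>
    (\<forall>t D. finite t \<and> t \<subseteq> C \<and> D \<in> H \<and> D \<subseteq> elems_above t C \<longrightarrow> \<not> box (s \<union> t) D \<subseteq> U)"
    using decide_all_or_reject_all[OF assms(2,3), of U] by blast
  have "box s C \<inter> U = {}"
    if rej: "\<And>t D. \<lbrakk>finite t; t \<subseteq> C; D \<in> H; D \<subseteq> elems_above t C\<rbrakk> \<Longrightarrow> \<not> box (s \<union> t) D \<subseteq> U"
  proof (rule ccontr)
    assume "box s C \<inter> U \<noteq> {}"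
    then obtain E where E: "E \<in> H" "s \<subseteq> E" "E \<subseteq> s \<union> C" "E \<in> U" by (auto simp: box_def)
    then have "\<exists>r\<subseteq>E. finite r \<and> box r E \<subseteq> U"
      using assms(1) unfolding ell_open_def by (metis IntI)
    then obtain r where r: "r \<subseteq> E" "finite r" "box r E \<subseteq> U" by blast
    \<comment> \<open>\<open>r\<close> may contain elements of \<open>s\<close> that are not in
      \<open>C\<close>, so only \<open>r - s\<close> can serve as the rejected set; the reservoir
      drops \<open>s\<close> for the same reason.\<close>
    define t where "t = r - s"
    define G where "G = elems_above t (E - s)"
    have t: "finite t" "t \<subseteq> C" using r E by (auto simp: t_def)
    have "E - s \<in> H" using H_finite_diff[OF E(1), of "E - s"] assms(2) by (simp add: Diff_Diff_Int)
    then have "G \<in> H" unfolding G_def using t(1) by (rule H_elems_above)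
    moreover have "G \<subseteq> elems_above t C" using E by (auto simp: G_def elems_above_def)
    moreover have "box (s \<union> t) G \<subseteq> box r E"
      using r E by (auto simp: box_def t_def G_def elems_above_def)
    ultimately show False using rej[OF t] r(3) by blast
  qed
  then show ?thesis using C dec by blast
qed

section \<open>Dense open sets and their countable intersections\<close>

text \<open>Density rules out the disjoint alternative of the Ramsey property. It is assumed only
  for stems below their reservoirs, as in the base of the topology, hence the passage to
  \<open>elems_above s C\<close>.\<close>

lemma ell_open_dense_box:
  assumes "ell_open V" and "finite s" "B \<in> H"
    and dense: "\<And>s C. \<lbrakk>finite s; C \<in> H; elems_above s C = C\<rbrakk> \<Longrightarrow> box s C \<inter> V \<noteq> {}"
  shows "\<exists>C\<in>H. C \<subseteq> B \<and> box s C \<subseteq> V"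
proof -
  obtain C where C: "C \<in> H" "C \<subseteq> B" "box s C \<subseteq> V \<or> box s C \<inter> V = {}"
    using ell_open_Ramsey[OF assms(1-3)] by blast
  have "box s (elems_above s C) \<inter> V \<noteq> {}"
    using assms(2) C(1) by (intro dense H_elems_above) (auto simp: elems_above_def)
  then show ?thesis using C box_mono[OF elems_above_subset, of s s C] by blast
qed

text \<open>Category argument by fusion: a stem \<open>t\<close> takes care of \<open>V 0\<close> up
  to \<open>V (card t)\<close>, finitely many sets at a time, and every \<open>E\<close> in
  \<open>box s C\<close> has stems of arbitrarily large size.\<close>

lemma ell_open_dense_Inter_box:
  fixes V :: "nat \<Rightarrow> nat set set"
  assumes "\<And>n. ell_open (V n)" and s: "finite s" "B \<in> H"
    and dense: "\<And>n s C. \<lbrakk>finite s; C \<in> H; elems_above s C = C\<rbrakk> \<Longrightarrow> box s C \<inter> V n \<noteq> {}"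
  shows "\<exists>C\<in>H. C \<subseteq> B \<and> box s C \<subseteq> (\<Inter>n. V n)"
proof -
  have "\<exists>C\<in>H. C \<subseteq> B \<and> (\<forall>t. finite t \<and> t \<subseteq> C \<longrightarrow>
      (\<forall>n\<in>{..card t}. box (s \<union> t) (elems_above t C) \<subseteq> V n))"
  proof (rule fusion[where Q = "\<lambda>t C. \<forall>n\<in>{..card t}. box (s \<union> t) C \<subseteq> V n"])
    fix t G :: "nat set" assume t: "finite t" and G: "G \<in> H"
    show "\<exists>C\<in>H. C \<subseteq> G \<and> (\<forall>n\<in>{..card t}. box (s \<union> t) C \<subseteq> V n)"
    proof (rule finite_family_dense[OF _ _ _ G])
      show "\<exists>C\<in>H. C \<subseteq> G \<and> box (s \<union> t) C \<subseteq> V n" if "G \<in> H" for n G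
        using ell_open_dense_box[OF assms(1) _ that dense] s t by blast
    qed (use box_mono in blast)+
  qed (use box_mono s in blast)+
  then obtain C where C: "C \<in> H" "C \<subseteq> B"
    "\<And>t n. \<lbrakk>finite t; t \<subseteq> C; n \<le> card t\<rbrakk> \<Longrightarrow> box (s \<union> t) (elems_above t C) \<subseteq> V n" by auto
  have "E \<in> V n" if E: "E \<in> box s C" for E n
  proof -
    have EH: "E \<in> H" "s \<subseteq> E" "E \<subseteq> s \<union> C" using E by (auto simp: box_def)
    have "infinite (E - s)" using H_infinite[OF EH(1)] s by simp
    from infinite_arbitrarily_large[OF this, of n]
    obtain q where q: "finite q" "q \<subseteq> E - s" "card q = n" by blast
    \<comment> \<open>The initial segment of \<open>E - s\<close> generated by \<open>q\<close>. It
      has at least \<open>n\<close> elements, and the rest of \<open>E - s\<close> lies above it,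
      which \<open>q\<close> alone would not ensure.\<close>
    define t where "t = {m \<in> E - s. \<exists>k\<in>q. m \<le> k}"
    have "t \<subseteq> (\<Union>k\<in>q. {..k})" by (auto simp: t_def)
    then have t: "finite t" by (rule finite_subset) (simp add: q(1))
    have "q \<subseteq> t" using q by (auto simp: t_def)
    then have "n \<le> card t" using q(3) t card_mono by blast
    moreover have "t \<subseteq> C" using EH by (auto simp: t_def)
    moreover have "E \<in> box (s \<union> t) (elems_above t C)"
    proof -
      have "k < m" if "m \<in> E" "m \<notin> s \<union> t" "k \<in> t" for m k
        using that unfolding t_def by auto
      moreover have "t \<subseteq> E" by (auto simp: t_def)
      ultimately show ?thesis using EH by (auto simp: box_def elems_above_def)
    qed
    ultimately show ?thesis using C(3) t by blast
  qed
  then show ?thesis using C by blast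
qed

end

section \<open>Selectivity of the coideal of \<open>\<omega>\<close>-covers\<close>

locale enumerated_omega_cover =
  fixes X :: "'x topology" and A :: "'x set set" and a :: "nat \<Rightarrow> 'x set"
  assumes S1: "S1 (omega_covers X) (omega_covers X)"
    and A: "A \<in> omega_covers X"
    and bij: "bij_betw a UNIV A"
begin

definition \<H> :: "nat set set" where
  "\<H> = {D. a ` D \<in> omega_covers X}"

lemma inj_a: "inj a" and range_a: "range a = A"
  using bij by (auto simp: bij_betw_def)

lemma a_open: "openin X (a n)" and a_subset: "a n \<subseteq> topspace X" and a_neq: "a n \<noteq> topspace X"
proof -
  have "a n \<in> A" using range_a by blast
  then show "openin X (a n)" "a n \<noteq> topspace X" using A by (auto simp: omega_covers_def)
  then show "a n \<subseteq> topspace X" by (simp add: openin_subset)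
qed

lemma omega_coversI:
  assumes "\<And>U. U \<in> \<U> \<Longrightarrow> openin X U" "\<And>U. U \<in> \<U> \<Longrightarrow> U \<noteq> topspace X"
    and "\<And>F. \<lbrakk>finite F; F \<subseteq> topspace X\<rbrakk> \<Longrightarrow> \<exists>U\<in>\<U>. F \<subseteq> U"
  shows "\<U> \<in> omega_covers X"
proof -
  have "x \<in> \<Union>\<U>" if "x \<in> topspace X" for x using assms(3)[of "{x}"] that by auto
  moreover have "U \<subseteq> topspace X" if "U \<in> \<U>" for U using assms(1)[OF that] by (rule openin_subset)
  ultimately have "\<Union>\<U> = topspace X" by blast
  then show ?thesis using assms by (auto simp: omega_covers_def)
qed

text \<open>Members of the image inherit openness and properness from \<open>A\<close>, and
  singletons take care of the union, so only the condition on finite sets remains.\<close>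

lemma \<H>_iff: "D \<in> \<H> \<longleftrightarrow> (\<forall>F. finite F \<and> F \<subseteq> topspace X \<longrightarrow> (\<exists>n\<in>D. F \<subseteq> a n))"
proof
  show "D \<in> \<H> \<Longrightarrow> \<forall>F. finite F \<and> F \<subseteq> topspace X \<longrightarrow> (\<exists>n\<in>D. F \<subseteq> a n)"
    by (auto simp: \<H>_def omega_covers_def)
  assume "\<forall>F. finite F \<and> F \<subseteq> topspace X \<longrightarrow> (\<exists>n\<in>D. F \<subseteq> a n)"
  then show "D \<in> \<H>" unfolding \<H>_def using a_open a_neq
    by (auto intro!: omega_coversI)
qed

lemma \<H>_obtain:
  assumes "D \<in> \<H>" "finite F" "F \<subseteq> topspace X"
  obtains n where "n \<in> D" "F \<subseteq> a n"
  using assms unfolding \<H>_iff by meson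

lemma not_\<H>_obtain:
  assumes "D \<notin> \<H>"
  obtains F where "finite F" "F \<subseteq> topspace X" "\<forall>n\<in>D. \<not> F \<subseteq> a n"
  using assms unfolding \<H>_iff by meson

lemma \<H>_mono: "\<lbrakk>C \<in> \<H>; C \<subseteq> D\<rbrakk> \<Longrightarrow> D \<in> \<H>"
  unfolding \<H>_iff by (meson subsetD)

text \<open>If finite sets \<open>F\<close> and \<open>G\<close> witness that \<open>C\<close> and
  \<open>D\<close> fail, no member indexed by \<open>C \<union> D\<close> contains
  \<open>F \<union> G\<close>.\<close>

lemma \<H>_Un:
  assumes "C \<union> D \<in> \<H>"
  shows "C \<in> \<H> \<or> D \<in> \<H>"
proof (rule ccontr)
  assume "\<not> (C \<in> \<H> \<or> D \<in> \<H>)"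
  then have "C \<notin> \<H>" "D \<notin> \<H>" by simp_all
  obtain F where F: "finite F" "F \<subseteq> topspace X" "\<forall>n\<in>C. \<not> F \<subseteq> a n"
    using \<open>C \<notin> \<H>\<close> by (rule not_\<H>_obtain)
  obtain G where G: "finite G" "G \<subseteq> topspace X" "\<forall>n\<in>D. \<not> G \<subseteq> a n"
    using \<open>D \<notin> \<H>\<close> by (rule not_\<H>_obtain)
  have "finite (F \<union> G)" "F \<union> G \<subseteq> topspace X" using F G by auto
  with assms obtain n where "n \<in> C \<union> D" "F \<union> G \<subseteq> a n" by (rule \<H>_obtain)
  then show False using F G by blast
qed

text \<open>With a point chosen outside each \<open>a n\<close>, a finite \<open>C\<close> would
  give a finite set contained in no \<open>a n\<close> with \<open>n \<in> C\<close>.\<close>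

lemma \<H>_infinite:
  assumes "C \<in> \<H>"
  shows "infinite C"
proof
  assume fin: "finite C"
  have "\<exists>x. x \<in> topspace X - a n" for n using a_subset[of n] a_neq[of n] by blast
  then obtain x where x: "\<And>n. x n \<in> topspace X - a n" by metis
  have "finite (x ` C)" "x ` C \<subseteq> topspace X" using fin x by auto
  with assms obtain n where "n \<in> C" "x ` C \<subseteq> a n" by (rule \<H>_obtain)
  then show False using x by blast
qed

section \<open>Selectivity from the selection principle\<close>

text \<open>\<open>S1\<close> picks an index \<open>v n\<close> in each \<open>S n\<close>; as
  \<open>S\<close> decreases, only the \<open>v i\<close> with \<open>i < n\<close> can lie outside
  \<open>S n\<close>.\<close>

lemma \<H>_pseudointersection:
  assumes S: "\<And>n. S n \<in> \<H>" and dec: "decseq S"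
  shows "\<exists>C\<in>\<H>. C \<subseteq> S 0 \<and> (\<forall>n. finite (C - S n))"
proof -
  have "\<forall>n. a ` S n \<in> omega_covers X" using S by (auto simp: \<H>_def)
  then obtain V where V: "\<And>n. V n \<in> a ` S n" "range V \<in> omega_covers X"
    using S1 unfolding S1_def by meson
  have "\<exists>i. i \<in> S n \<and> V n = a i" for n using V(1)[of n] by blast
  then obtain v where v: "\<And>n. v n \<in> S n" "\<And>n. V n = a (v n)" by metis
  have "range V = a ` range v" using v(2) by auto
  then have "range v \<in> \<H>" using V(2) by (simp add: \<H>_def)
  moreover have "range v \<subseteq> S 0" using v(1) decseqD[OF dec, of 0] by blast
  moreover have "finite (range v - S n)" for n
  proof -
    have "range v - S n \<subseteq> v ` {..<n}"
      using v(1) decseqD[OF dec, of n] by (force simp: not_less[symmetric])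
    then show ?thesis by (rule finite_subset) simp
  qed
  ultimately show ?thesis by blast
qed

text \<open>Applying \<open>S\<^sub>1\<close> to intersections of \<open>n + 1\<close> members from different fibres leaves, at stage
  \<open>n\<close>, at least one factor whose fibre has not been used before.\<close>

lemma \<H>_selector:
  fixes f :: "nat \<Rightarrow> nat"
  assumes C: "C \<in> \<H>" and fib: "\<And>k. finite {m \<in> C. f m = k}"
  shows "\<exists>D\<in>\<H>. D \<subseteq> C \<and> inj_on f D"
proof -
  define \<U> where "\<U> n = {\<Inter>(a ` S) | S. S \<subseteq> C \<and> card S = Suc n \<and> inj_on f S}" for n
  have "\<U> n \<in> omega_covers X" for n
  proof (rule omega_coversI)
    fix U assume "U \<in> \<U> n"
    then obtain S where S: "U = \<Inter>(a ` S)" "card S = Suc n" by (auto simp: \<U>_def)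
    then have fin: "finite S" "S \<noteq> {}" using card.infinite by fastforce+
    then show "openin X U" unfolding S(1) using a_open by (intro openin_Inter) auto
    obtain i where "i \<in> S" using fin by blast
    then have "U \<subseteq> a i" using S by blast
    then show "U \<noteq> topspace X" using a_subset[of i] a_neq[of i] by blast
  next
    fix F assume F: "finite F" "F \<subseteq> topspace X"
    \<comment> \<open>By the partition property the indices whose sets contain \<open>F\<close>
      still form a member of \<open>\<H>\<close>, hence an infinite set, and finite fibres force
      infinitely many values of \<open>f\<close> on it.\<close>
    define I where "I = {i \<in> C. F \<subseteq> a i}"
    have "C - I \<notin> \<H>" using \<H>_obtain[OF _ F, of "C - I"] by (auto simp: I_def)
    moreover have "I \<union> (C - I) = C" by (auto simp: I_def)
    ultimately have "I \<in> \<H>" using \<H>_Un C by metis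
    then have "infinite I" by (rule \<H>_infinite)
    have "infinite (f ` I)"
    proof
      assume "finite (f ` I)"
      then have "finite (\<Union>k\<in>f ` I. {m \<in> C. f m = k})" using fib by blast
      moreover have "I \<subseteq> (\<Union>k\<in>f ` I. {m \<in> C. f m = k})" by (auto simp: I_def)
      ultimately show False using \<open>infinite I\<close> finite_subset by blast
    qed
    from infinite_arbitrarily_large[OF this, of "Suc n"]
    obtain T where T: "T \<subseteq> f ` I" "card T = Suc n" by blast
    then obtain S where S: "S \<subseteq> I" "inj_on f S" "T = f ` S" by (auto simp: subset_image_inj)
    then have "card S = Suc n" using T(2) card_image by metis
    then have "\<Inter>(a ` S) \<in> \<U> n" using S by (auto simp: \<U>_def I_def)
    moreover have "F \<subseteq> \<Inter>(a ` S)" using S by (auto simp: I_def)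
    ultimately show "\<exists>U\<in>\<U> n. F \<subseteq> U" by blast
  qed
  then obtain V where V: "\<And>n. V n \<in> \<U> n" "range V \<in> omega_covers X"
    using S1 unfolding S1_def by meson
  have "\<exists>S. V n = \<Inter>(a ` S) \<and> S \<subseteq> C \<and> card S = Suc n \<and> inj_on f S" for n
    using V(1)[of n] unfolding \<U>_def by blast
  then obtain S where S: "\<And>n. V n = \<Inter>(a ` S n)" "\<And>n. S n \<subseteq> C" "\<And>n. card (S n) = Suc n"
    "\<And>n. inj_on f (S n)" by metis
  have pick: "\<exists>i \<in> S n. f i \<notin> f ` w ` {..<n}" for n and w :: "nat \<Rightarrow> nat"
  proof (rule ccontr)
    assume "\<not> (\<exists>i \<in> S n. f i \<notin> f ` w ` {..<n})"
    then have "f ` S n \<subseteq> (f \<circ> w) ` {..<n}" by auto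
    then have "card (f ` S n) \<le> card {..<n}" using surj_card_le by blast
    then show False using S(3)[of n] card_image[OF S(4)[of n]] by simp
  qed
  have "\<exists>w. \<forall>n. w n \<in> S n \<and> f (w n) \<notin> f ` w ` {..<n}"
  proof (rule dependent_wellorder_choice)
    show "\<exists>i. i \<in> S n \<and> f i \<notin> f ` w ` {..<n}" for n w using pick by blast
  qed (auto simp: image_iff)
  then obtain w where w: "\<And>n. w n \<in> S n" "\<And>n. f (w n) \<notin> f ` w ` {..<n}" by blast
  have "f (w m) \<noteq> f (w n)" if "m < n" for m n
    using w(2)[of n] that by (metis imageI lessThan_iff)
  then have "inj_on f (range w)" unfolding inj_on_def by (metis imageE linorder_neqE_nat)
  \<comment> \<open>\<open>V n\<close> is contained in each of its factors, in particular in
    \<open>a (w n)\<close>, so finite sets remain covered.\<close>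
  moreover have "range w \<in> \<H>"
    unfolding \<H>_iff
  proof (intro allI impI)
    fix F assume "finite F \<and> F \<subseteq> topspace X"
    then obtain n where "F \<subseteq> V n" using V(2) by (auto simp: omega_covers_def)
    then show "\<exists>n\<in>range w. F \<subseteq> a n" using S(1)[of n] w(1)[of n] by blast
  qed
  moreover have "range w \<subseteq> C" using w(1) S(2) by blast
  ultimately show ?thesis by blast
qed

text \<open>The naturals are cut at points \<open>k i\<close> such that members of a
  pseudo-intersection \<open>B\<close> from \<open>k (Suc i)\<close> on lie in
  \<open>S (Suc (k i))\<close>. If \<open>n\<close> is in block \<open>i\<close> and
  \<open>m\<close> at least two blocks later, then \<open>m\<close> is in
  \<open>S (Suc (k (Suc i)))\<close>, and this is contained in \<open>S (Suc n)\<close> because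
  \<open>n < k (Suc i)\<close>. The selector provides a set with at most one point per
  block.\<close>

lemma \<H>_diagonal:
  assumes S: "\<And>n. S n \<in> \<H>" and dec: "decseq S"
  shows "\<exists>C\<in>\<H>. C \<subseteq> S 0 \<and> (\<forall>n\<in>C. \<forall>m\<in>C. n < m \<longrightarrow> m \<in> S (Suc n))"
proof -
  obtain B where B: "B \<in> \<H>" "B \<subseteq> S 0" "\<And>n. finite (B - S n)"
    using \<H>_pseudointersection[OF assms] by blast
  have step: "\<exists>l. k < l \<and> (\<forall>m\<in>B. l \<le> m \<longrightarrow> m \<in> S (Suc k))" for k
  proof -
    obtain b where "\<forall>m \<in> B - S (Suc k). m < b"
      using B(3)[of "Suc k"] finite_nat_set_iff_bounded by blast
    then have "m \<in> S (Suc k)" if "m \<in> B" "b \<le> m" for m using that by (meson DiffI leD)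
    then show ?thesis by (intro exI[of _ "max b (Suc k)"]) auto
  qed
  have "\<exists>k. \<forall>i. (i = 0 \<longrightarrow> k i = 0) \<and>
      k i < k (Suc i) \<and> (\<forall>m\<in>B. k (Suc i) \<le> m \<longrightarrow> m \<in> S (Suc (k i)))"
    by (rule dependent_nat_choice) (use step in auto)
  then obtain k where k: "k 0 = (0::nat)" "\<And>i. k i < k (Suc i)"
    "\<And>i m. \<lbrakk>m \<in> B; k (Suc i) \<le> m\<rbrakk> \<Longrightarrow> m \<in> S (Suc (k i))"
    by metis
  have mono: "strict_mono k" using k(2) by (simp add: strict_mono_Suc_iff)
  \<comment> \<open>\<open>f m\<close> is the number of the block \<open>{k i..<k (Suc i)}\<close>
    containing \<open>m\<close>; \<open>k 0 = 0\<close> puts every \<open>m\<close> into a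
    block.\<close>
  define f where "f m = (LEAST i. m < k (Suc i))" for m
  have f_upper: "m < k (Suc (f m))" for m
  proof -
    have "m < k (Suc m)" using strict_mono_imp_increasing[OF mono, of "Suc m"] by simp
    then show ?thesis unfolding f_def by (rule LeastI)
  qed
  have f_lower: "k (f m) \<le> m" for m
  proof (cases "f m")
    case (Suc i)
    then have "\<not> m < k (Suc i)" using not_less_Least[of i "\<lambda>i. m < k (Suc i)"] by (simp add: f_def)
    then show ?thesis using Suc by simp
  qed (simp add: k(1))
  have "finite {m \<in> B. f m = i}" for i
  proof -
    have "{m \<in> B. f m = i} \<subseteq> {..<k (Suc i)}" using f_upper by auto
    then show ?thesis by (rule finite_subset) simp
  qed
  then obtain D where D: "D \<in> \<H>" "D \<subseteq> B" "inj_on f D" using \<H>_selector[OF B(1)] by blast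
  have "{m \<in> D. even (f m)} \<union> {m \<in> D. odd (f m)} = D" by auto
  then have "{m \<in> D. even (f m)} \<in> \<H> \<or> {m \<in> D. odd (f m)} \<in> \<H>" using \<H>_Un D(1) by metis
  \<comment> \<open>Restricting to one parity leaves a full block between any two members.\<close>
  then obtain C where C: "C \<in> \<H>" "C \<subseteq> D" "\<And>n m. \<lbrakk>n \<in> C; m \<in> C\<rbrakk> \<Longrightarrow> even (f n) = even (f m)"
    by (elim disjE) (rule that, auto)+
  have "m \<in> S (Suc n)" if nm: "n \<in> C" "m \<in> C" "n < m" for n m
  proof -
    have "k (f n) < k (Suc (f m))" using f_lower[of n] f_upper[of m] nm by linarith
    then have "f n \<le> f m" using strict_mono_less[OF mono] by (simp add: less_Suc_eq_le)
    moreover have "f n \<noteq> f m" using D(3) C(2) nm by (auto dest: inj_onD)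
    moreover have "f m \<noteq> Suc (f n)" using C(3)[of n m] nm by auto
    ultimately have "Suc (Suc (f n)) \<le> f m" by simp
    then have "k (Suc (Suc (f n))) \<le> m"
      using f_lower[of m] strict_mono_less_eq[OF mono] order_trans by blast
    then have "m \<in> S (Suc (k (Suc (f n))))" using k(3) nm C D by blast
    moreover have "S (Suc (k (Suc (f n)))) \<subseteq> S (Suc n)"
      using decseqD[OF dec] f_upper[of n] by simp
    ultimately show ?thesis by blast
  qed
  moreover have "C \<subseteq> S 0" using C(2) D(2) B(2) by blast
  ultimately show ?thesis using C(1) by auto
qed

sublocale selective_coideal \<H>
  by unfold_locales (fact \<H>_infinite \<H>_mono \<H>_Un \<H>_diagonal)+

section \<open>Transfer to the Ellentuck topology\<close>

definition ell_space :: "'x set set topology" where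
  "ell_space = subtopology (ellentuck_topology a A) (inf_subsets A \<inter> omega_covers X)"

lemma inf_subsets_image: "C \<in> \<H> \<Longrightarrow> a ` C \<in> inf_subsets A"
  using \<H>_infinite[of C] range_a inj_a
  by (auto simp: inf_subsets_def finite_image_iff inj_on_subset)

lemma topspace_ell_space: "topspace ell_space = inf_subsets A \<inter> omega_covers X"
  using bij by (simp add: ell_space_def topspace_subtopology topspace_ellentuck_topology)

text \<open>The infinite part that \<open>ellentuck_box\<close> asks for is the image of
  \<open>E - s\<close>, which stays in \<open>\<H>\<close> because \<open>s\<close> is finite;
  injectivity of \<open>a\<close> gives the other direction.\<close>

lemma image_in_ellentuck_box_iff:
  assumes "finite s" "E \<in> \<H>"
  shows "a ` E \<in> ellentuck_box A (a ` s) (a ` C) \<longleftrightarrow> E \<in> box s C"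
proof
  assume "a ` E \<in> ellentuck_box A (a ` s) (a ` C)"
  then obtain D where "a ` E = a ` s \<union> D" "D \<subseteq> a ` C" by (auto simp: ellentuck_box_def)
  then have "a ` s \<subseteq> a ` E" "a ` E \<subseteq> a ` (s \<union> C)" by auto
  then have "s \<subseteq> E" "E \<subseteq> s \<union> C" using inj_a by (simp_all only: inj_image_subset_iff)
  then show "E \<in> box s C" using assms by (simp add: box_def)
next
  assume "E \<in> box s C"
  then have E: "s \<subseteq> E" "E \<subseteq> s \<union> C" by (auto simp: box_def)
  have "E - s \<in> \<H>" using H_finite_diff[OF assms(2), of "E - s"] assms(1) by (simp add: Diff_Diff_Int)
  then have "a ` (E - s) \<in> inf_subsets A" by (rule inf_subsets_image)
  moreover have "a ` E = a ` s \<union> a ` (E - s)" "a ` (E - s) \<subseteq> a ` C" using E by auto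
  ultimately show "a ` E \<in> ellentuck_box A (a ` s) (a ` C)"
    unfolding ellentuck_box_def by blast
qed

lemma ellentuck_box_cases:
  assumes "Z \<in> ellentuck_box A (a ` s) (a ` C) \<inter> omega_covers X" "finite s"
  obtains E where "Z = a ` E" "E \<in> box s C"
proof -
  obtain D where "Z = a ` s \<union> D" "D \<subseteq> a ` C" using assms by (auto simp: ellentuck_box_def)
  then have "Z \<subseteq> range a" by blast
  then obtain E where E: "Z = a ` E" by (auto simp: subset_image_iff)
  then have "E \<in> \<H>" using assms by (simp add: \<H>_def)
  then show ?thesis using that E assms image_in_ellentuck_box_iff by auto
qed

text \<open>A basic neighbourhood of the image of \<open>E\<close> pulls back to some
  \<open>box s C\<close> containing \<open>E\<close>, and this contains
  \<open>box s E\<close>.\<close>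

lemma ell_open_vimage:
  assumes "openin ell_space U"
  shows "ell_open {E. a ` E \<in> U}"
  unfolding ell_open_def
proof
  fix E assume "E \<in> {E. a ` E \<in> U} \<inter> \<H>"
  then have E: "a ` E \<in> U" "E \<in> \<H>" by auto
  obtain W where W: "openin (ellentuck_topology a A) W" "U = W \<inter> (inf_subsets A \<inter> omega_covers X)"
    using assms by (auto simp: ell_space_def openin_subtopology)
  obtain P where P: "P \<in> ellentuck_base a A" "a ` E \<in> P" "P \<subseteq> W"
    using W(1) E(1) W(2) unfolding openin_ellentuck_topology arbitrary_union_of_alt by blast
  obtain s' C' where s': "P = ellentuck_box A s' C'" "finite s'" "s' \<subseteq> A" "C' \<subseteq> A"
    using P(1) by (auto simp: ellentuck_base_def inf_subsets_def)
  obtain s C where s: "s' = a ` s" "C' = a ` C"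
    using s'(3,4) by (metis range_a subset_image_iff)
  have fs: "finite s" using s'(2) s(1) inj_a by (simp add: finite_image_iff inj_on_subset)
  have "E \<in> box s C" using P(2) s' s image_in_ellentuck_box_iff[OF fs E(2)] by simp
  then have sE: "s \<subseteq> E" "E \<subseteq> s \<union> C" by (auto simp: box_def)
  have "box s E \<subseteq> {E. a ` E \<in> U}"
  proof
    fix F assume F: "F \<in> box s E"
    then have FH: "F \<in> \<H>" by (simp add: box_def)
    have "F \<in> box s C" using F sE by (auto simp: box_def)
    then have "a ` F \<in> P" using s' s image_in_ellentuck_box_iff[OF fs FH] by simp
    then show "F \<in> {E. a ` E \<in> U}"
      using P(3) W(2) inf_subsets_image[OF FH] FH by (auto simp: \<H>_def)
  qed
  then show "\<exists>s\<subseteq>E. finite s \<and> box s E \<subseteq> {E. a ` E \<in> U}" using sE fs by blast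
qed

section \<open>Category and the Baire property\<close>

text \<open>Otherwise the trace of a basic box would be a nonempty open set inside the closure of
  \<open>N\<close>. The condition \<open>elems_above s C = C\<close> supplies the
  \<open>enum_less\<close> demanded by the base.\<close>

lemma box_meets_nowhere_dense_complement:
  assumes N: "ell_space interior_of (ell_space closure_of N) = {}"
    and s: "finite s" "C \<in> \<H>" "elems_above s C = C"
  shows "box s C \<inter> {E. a ` E \<in> topspace ell_space - ell_space closure_of N} \<noteq> {}"
proof
  assume dis: "box s C \<inter> {E. a ` E \<in> topspace ell_space - ell_space closure_of N} = {}"
  define P where "P = ellentuck_box A (a ` s) (a ` C)"
  have "enum_less a (a ` s) (a ` C)"
    using s(3) inj_a by (auto simp: enum_less_def elems_above_def inj_image_mem_iff)
  then have "P \<in> ellentuck_base a A"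
    unfolding ellentuck_base_def P_def using s range_a inf_subsets_image[OF s(2)] by blast
  then have "openin (ellentuck_topology a A) P"
    unfolding openin_ellentuck_topology by (rule arbitrary_union_of_inc)
  then have "openin ell_space (P \<inter> (inf_subsets A \<inter> omega_covers X))"
    unfolding ell_space_def by (auto simp: openin_subtopology)
  moreover have "P \<inter> (inf_subsets A \<inter> omega_covers X) \<subseteq> ell_space closure_of N"
  proof
    fix Z assume Z: "Z \<in> P \<inter> (inf_subsets A \<inter> omega_covers X)"
    then obtain E where "Z = a ` E" "E \<in> box s C"
      using ellentuck_box_cases[of Z s C] s(1) by (auto simp: P_def)
    then show "Z \<in> ell_space closure_of N" using dis Z topspace_ell_space by blast
  qed
  ultimately have "P \<inter> (inf_subsets A \<inter> omega_covers X) \<subseteq> {}"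
    using interior_of_maximal N by metis
  moreover have "a ` (s \<union> C) \<in> P \<inter> (inf_subsets A \<inter> omega_covers X)"
  proof -
    have sC: "s \<union> C \<in> \<H>" using s(2) \<H>_mono by blast
    then have "s \<union> C \<in> box s C" by (simp add: box_def)
    then have "a ` (s \<union> C) \<in> P"
      using image_in_ellentuck_box_iff[OF s(1) sC] by (simp add: P_def)
    then show ?thesis using inf_subsets_image[OF sC] sC unfolding \<H>_def by blast
  qed
  ultimately show False by blast
qed

lemma baire_property_imp_Ramsey:
  assumes "has_baire_property ell_space R" "finite s" "B \<in> \<H>"
  shows "\<exists>C\<in>\<H>. C \<subseteq> B \<and> (box s C \<subseteq> {E. a ` E \<in> R} \<or> box s C \<inter> {E. a ` E \<in> R} = {})"
proof -
  obtain U M where U: "openin ell_space U" and M: "meager_in ell_space M"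
    and R: "R = (U - M) \<union> (M - U)"
    using assms(1) unfolding has_baire_property_def by metis
  obtain N :: "nat \<Rightarrow> 'x set set set" where
    "\<forall>n. N n \<subseteq> topspace ell_space \<and> ell_space interior_of (ell_space closure_of N n) = {}"
    and MN: "M = (\<Union>n. N n)"
    using M unfolding meager_in_def by metis
  then have N: "\<And>n. N n \<subseteq> topspace ell_space"
    "\<And>n. ell_space interior_of (ell_space closure_of N n) = {}" by simp_all
  \<comment> \<open>Complements of the closures of the nowhere dense pieces are open and dense, so
    some box lies in all of them and misses \<open>M\<close>.\<close>
  define V where "V n = {E. a ` E \<in> topspace ell_space - ell_space closure_of N n}" for n
  have "ell_open (V n)" for n
    unfolding V_def by (intro ell_open_vimage openin_diff) auto
  moreover have "box s C \<inter> V n \<noteq> {}" if "finite s" "C \<in> \<H>" "elems_above s C = C" for n s C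
    unfolding V_def using box_meets_nowhere_dense_complement N(2) that by blast
  ultimately obtain C where C: "C \<in> \<H>" "C \<subseteq> B" "box s C \<subseteq> (\<Inter>n. V n)"
    using ell_open_dense_Inter_box[of V s B] assms(2,3) by blast
  have avoid: "a ` E \<notin> M" if "E \<in> box s C" for E
  proof -
    have "a ` E \<notin> N n" for n
      using that C(3) closure_of_subset[OF N(1)[of n]] unfolding V_def by blast
    then show ?thesis using MN by blast
  qed
  \<comment> \<open>Inside \<open>box s C\<close> the sets \<open>R\<close> and \<open>U\<close>
    agree, so it is enough to decide the open set \<open>U\<close>.\<close>
  obtain D where D: "D \<in> \<H>" "D \<subseteq> C" "box s D \<subseteq> {E. a ` E \<in> U} \<or> box s D \<inter> {E. a ` E \<in> U} = {}"
    using ell_open_Ramsey[OF ell_open_vimage[OF U] assms(2) C(1)] by blast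
  have "\<forall>E\<in>box s D. a ` E \<in> R \<longleftrightarrow> a ` E \<in> U"
    using avoid box_mono[OF D(2)] R by blast
  then show ?thesis using C D by (intro bexI[of _ D]) auto
qed

lemma baire_property_imp_completely_Ramsey:
  assumes "R \<subseteq> inf_subsets A \<inter> omega_covers X" "has_baire_property ell_space R"
  shows "completely_Ramsey X a A R"
  unfolding completely_Ramsey_def
proof (intro conjI allI impI)
  fix s' B' assume *: "finite s' \<and> s' \<subseteq> A \<and> B' \<in> inf_subsets (enum_above a A s') \<inter> omega_covers X"
  then have "B' \<subseteq> A" by (auto simp: inf_subsets_def enum_above_def)
  then obtain s B where s: "s' = a ` s" "B' = a ` B" using * by (metis range_a subset_image_iff)
  have fs: "finite s" using * s(1) inj_a by (simp add: finite_image_iff inj_on_subset)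
  have "B \<in> \<H>" using * s by (simp add: \<H>_def)
  then obtain C where C: "C \<in> \<H>" "C \<subseteq> B"
    "box s C \<subseteq> {E. a ` E \<in> R} \<or> box s C \<inter> {E. a ` E \<in> R} = {}"
    using baire_property_imp_Ramsey[OF assms(2) fs] by blast
  have "a ` C \<in> inf_subsets B' \<inter> omega_covers X"
    using C inf_subsets_image[OF C(1)] s by (auto simp: inf_subsets_def \<H>_def)
  \<comment> \<open>Every \<omega>-cover in the Ellentuck box is the image of a member of
    \<open>box s C\<close>, so the dichotomy for index sets decides the whole trace.\<close>
  moreover have "ellentuck_box A s' (a ` C) \<inter> omega_covers X \<subseteq> (`) a ` box s C"
    using ellentuck_box_cases[OF _ fs] s by blast
  ultimately show "\<exists>C\<in>inf_subsets B' \<inter> omega_covers X.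
      ellentuck_box A s' C \<inter> omega_covers X \<subseteq> R \<or> ellentuck_box A s' C \<inter> omega_covers X \<inter> R = {}"
    using C(3) by (intro bexI[of _ "a ` C"]) blast+
qed (fact assms(1))

end

theorem theorem7:
  fixes X :: "'x topology" and A :: "'x set set" and a :: "nat \<Rightarrow> 'x set" and R :: "'x set set set"
  assumes "S1 (omega_covers X) (omega_covers X)"
    and "A \<in> omega_covers X" and "countable A"
    and "bij_betw a UNIV A"
    and "R \<subseteq> inf_subsets A \<inter> omega_covers X"
    and "has_baire_property
           (subtopology (ellentuck_topology a A) (inf_subsets A \<inter> omega_covers X)) R"
  shows "completely_Ramsey X a A R"
proof -
  interpret enumerated_omega_cover X A a
    by unfold_locales (fact assms)+
  show ?thesis
    using assms(5,6) unfolding ell_space_def[symmetric]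
    by (rule baire_property_imp_completely_Ramsey)
qed

end
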